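(* Let $A\in\mathbb{R}^{d\times d}$ be an arbitrary constant matrix and consider the differential Lyapunov equation $\dot X(t)=AX(t)+X(t)A^\top+Q(t)$, $X(t_0)=X_0$, where $Q(t)\in\mathbb{R}^{d\times d}$ is symmetric positive semidefinite (SPSD) and may depend on $X(t)$. Assume that $X^0\in\mathbb{R}^{d\times d}$ is SPSD. Then for any time step $\tau>0$ and any integer $n\ge 0$, the matrix $X^{n+1}$ produced by the IF-SSPRK2 scheme $$\widehat{X}^{n+1}=e^{\tau A}X^n e^{\tau A^\top}+\tau e^{\tau A}Q^n e^{\tau A^\top},$$ $$\widehat{X}^{n+2}=e^{\tau A}\widehat{X}^{n+1}e^{\tau A^\top}+\tau e^{\tau A}Q^{n+1}e^{\tau A^\top},$$ $$X^{n+1}=\tfrac12 e^{\tau A}X^n e^{\tau A^\top}+\tfrac12 e^{-\tau A}\widehat{X}^{n+2}e^{-\tau A^\top}$$ is SPSD.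
   Context: SPSD means symmetric (real) and positive semidefinite. The grid is $t_n=t_0+n\tau$. The matrices $Q^n$ and $Q^{n+1}$ denote the values of $Q$ used in the first and second stages of step $n$, at times $t_n$ and $t_{n+1}$ (if $Q$ depends on $X$, they are evaluated at the stage values $X^n$ and $\widehat X^{n+1}$, respectively). The standing assumption is that all values of $Q$ occurring in the scheme are SPSD. In each step from $X^n$ to $X^{n+1}$, the hatted quantities $\widehat X^{n+1},\widehat X^{n+2}$ are auxiliary stage values recomputed in that step. $e^{B}$ is the matrix exponential. *)

theory Defs
  imports "HOL-Analysis.Analysis"
begin

definition spsd :: "real ^ 'd ^ 'd \<Rightarrow> bool" where
  "spsd M \<longleftrightarrow> transpose M = M \<and> (\<forall>x. 0 \<le> x \<bullet> (M *v x))"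

(* The library's multiplication and power on vec types are componentwise, hence
   powers and the exponential series are set up here for the matrix product. *)

primrec matpow :: "real ^ 'd ^ 'd \<Rightarrow> nat \<Rightarrow> real ^ 'd ^ 'd" where
  "matpow B 0 = mat 1"
| "matpow B (Suc k) = B ** matpow B k"

definition mexp :: "real ^ 'd ^ 'd \<Rightarrow> real ^ 'd ^ 'd" where
  "mexp B = (\<Sum>k. (1 / fact k) *\<^sub>R matpow B k)"

lemma bilinear_matrix_matrix_mult:
  "bilinear ((**) :: real ^ 'd ^ 'd \<Rightarrow> real ^ 'd ^ 'd \<Rightarrow> real ^ 'd ^ 'd)"
  unfolding bilinear_def
  by (auto intro!: linearI
      simp: matrix_matrix_mult_def vec_eq_iff sum.distrib sum_distrib_left algebra_simps)

lemma summable_mexp: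
  fixes B :: "real ^ 'd ^ 'd"
  shows "summable (\<lambda>k. (1 / fact k) *\<^sub>R matpow B k)"
proof -
  have bb: "bounded_bilinear ((**) :: real ^ 'd ^ 'd \<Rightarrow> real ^ 'd ^ 'd \<Rightarrow> real ^ 'd ^ 'd)"
    using bilinear_matrix_matrix_mult by (simp add: bilinear_conv_bounded_bilinear)
  then obtain K where K: "K > 0"
    "\<And>(M :: real ^ 'd ^ 'd) (N :: real ^ 'd ^ 'd). norm (M ** N) \<le> norm M * norm N * K"
    using bounded_bilinear.pos_bounded[OF bb] by auto
  have pow: "norm (matpow B k) \<le> norm (mat 1 :: real ^ 'd ^ 'd) * (norm B * K) ^ k" for k
  proof (induction k)
    case 0
    then show ?case by simp
  next
    case (Suc k)
    have "norm (matpow B (Suc k)) \<le> (norm B * K) * norm (matpow B k)"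
      using K(2)[of B "matpow B k"] by (simp add: mult_ac)
    also have "\<dots> \<le> (norm B * K) * (norm (mat 1 :: real ^ 'd ^ 'd) * (norm B * K) ^ k)"
      using Suc K(1) by (intro mult_left_mono) auto
    finally show ?case by (simp add: mult_ac)
  qed
  show ?thesis
  proof (rule summable_comparison_test')
    show "summable (\<lambda>k. norm (mat 1 :: real ^ 'd ^ 'd) * (inverse (fact k) * (norm B * K) ^ k))"
      by (intro summable_mult summable_exp)
    show "norm ((1 / fact k) *\<^sub>R matpow B k)
        \<le> norm (mat 1 :: real ^ 'd ^ 'd) * (inverse (fact k) * (norm B * K) ^ k)"
      if "k \<ge> 0" for k
      using mult_left_mono[OF pow[of k], of "inverse (fact k)"]
      by (simp add: divide_inverse mult_ac)
  qed
qed

definition grid_time :: "real \<Rightarrow> real \<Rightarrow> nat \<Rightarrow> real" where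
  "grid_time t0 \<tau> n = t0 + real n * \<tau>"

(* In the following, Q is a function of the time and of the current matrix X; a source term
   depending on time only ignores its second argument. The argument X of the stages is the
   current iterate, so stage1 and stage2 are the hatted values of index n + 1 and n + 2
   recomputed in the step from n to n + 1. *)

definition if_ssprk2_stage1 ::
  "real ^ 'd ^ 'd \<Rightarrow> (real \<Rightarrow> real ^ 'd ^ 'd \<Rightarrow> real ^ 'd ^ 'd) \<Rightarrow> real \<Rightarrow> real
    \<Rightarrow> nat \<Rightarrow> real ^ 'd ^ 'd \<Rightarrow> real ^ 'd ^ 'd" where
  "if_ssprk2_stage1 A Q t0 \<tau> n X =
     mexp (\<tau> *\<^sub>R A) ** X ** mexp (\<tau> *\<^sub>R transpose A)
     + \<tau> *\<^sub>R (mexp (\<tau> *\<^sub>R A) ** Q (grid_time t0 \<tau> n) X ** mexp (\<tau> *\<^sub>R transpose A))"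

definition if_ssprk2_stage2 ::
  "real ^ 'd ^ 'd \<Rightarrow> (real \<Rightarrow> real ^ 'd ^ 'd \<Rightarrow> real ^ 'd ^ 'd) \<Rightarrow> real \<Rightarrow> real
    \<Rightarrow> nat \<Rightarrow> real ^ 'd ^ 'd \<Rightarrow> real ^ 'd ^ 'd" where
  "if_ssprk2_stage2 A Q t0 \<tau> n X =
     mexp (\<tau> *\<^sub>R A) ** if_ssprk2_stage1 A Q t0 \<tau> n X ** mexp (\<tau> *\<^sub>R transpose A)
     + \<tau> *\<^sub>R (mexp (\<tau> *\<^sub>R A)
              ** Q (grid_time t0 \<tau> (Suc n)) (if_ssprk2_stage1 A Q t0 \<tau> n X)
              ** mexp (\<tau> *\<^sub>R transpose A))"

primrec if_ssprk2 ::
  "real ^ 'd ^ 'd \<Rightarrow> (real \<Rightarrow> real ^ 'd ^ 'd \<Rightarrow> real ^ 'd ^ 'd) \<Rightarrow> real \<Rightarrow> real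
    \<Rightarrow> real ^ 'd ^ 'd \<Rightarrow> nat \<Rightarrow> real ^ 'd ^ 'd" where
  "if_ssprk2 A Q t0 \<tau> X0 0 = X0"
| "if_ssprk2 A Q t0 \<tau> X0 (Suc n) =
     (1 / 2) *\<^sub>R (mexp (\<tau> *\<^sub>R A) ** if_ssprk2 A Q t0 \<tau> X0 n ** mexp (\<tau> *\<^sub>R transpose A))
     + (1 / 2) *\<^sub>R (mexp (- (\<tau> *\<^sub>R A))
                  ** if_ssprk2_stage2 A Q t0 \<tau> n (if_ssprk2 A Q t0 \<tau> X0 n)
                  ** mexp (- (\<tau> *\<^sub>R transpose A)))"

end

(* Every term of the scheme is a congruence E ** M ** transpose E of an SPSD matrix M with
   E = mexp (+- \<tau> A), because transposition commutes with the exponential.  Congruences,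
   sums and nonnegative multiples preserve SPSD matrices, so no identity such as
   mexp (- B) ** mexp B = mat 1 is needed. *)
theory Submission
  imports Defs
begin

text \<open>\<open>matpow\<close> adds its new factor on the left, whereas transposition reverses
  products and leaves it on the right; commuting the factor past the power reconciles the
  two.\<close>

lemma matpow_commute: "matpow B k ** B = B ** matpow B k"
  by (induction k) (simp_all flip: matrix_mul_assoc)

lemma transpose_matpow: "transpose (matpow B k) = matpow (transpose B) k"
  by (induction k) (simp_all add: matrix_transpose_mul matpow_commute)

lemma linear_transpose: "linear (transpose :: real ^ 'n ^ 'm \<Rightarrow> real ^ 'm ^ 'n)"
  by (auto intro!: linearI simp: transpose_def vec_eq_iff)

text \<open>A linear map in finite dimension is bounded, so transposition passes through the
  convergent exponential series term by term.\<close>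

lemma transpose_mexp: "transpose (mexp B) = mexp (transpose B)"
proof -
  have "bounded_linear (transpose :: real ^ 'a ^ 'a \<Rightarrow> real ^ 'a ^ 'a)"
    using linear_transpose by (simp add: linear_conv_bounded_linear)
  from bounded_linear.suminf[OF this summable_mexp[of B]]
  show ?thesis
    unfolding mexp_def by (simp add: linear_cmul[OF linear_transpose] transpose_matpow)
qed

lemma spsd_add:
  assumes "spsd M" and "spsd N"
  shows "spsd (M + N)"
  using assms unfolding spsd_def
  by (simp add: linear_add[OF linear_transpose] matrix_vector_mult_add_rdistrib inner_add_right)

lemma spsd_scaleR:
  assumes "spsd M" and "0 \<le> c"
  shows "spsd (c *\<^sub>R M)"
  using assms unfolding spsd_def
  by (simp add: linear_cmul[OF linear_transpose] scaleR_matrix_vector_assoc[symmetric])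

text \<open>The quadratic form at \<open>x\<close> is that of \<open>M\<close> at
  \<open>transpose E *v x\<close>.\<close>

lemma spsd_congruence:
  assumes "spsd M"
  shows "spsd (E ** M ** transpose E)"
proof -
  have "x \<bullet> ((E ** M ** transpose E) *v x)
      = (transpose E *v x) \<bullet> (M *v (transpose E *v x))" for x
    by (simp add: dot_lmul_matrix flip: matrix_vector_mul_assoc)
  with assms show ?thesis
    unfolding spsd_def by (simp add: matrix_transpose_mul matrix_mul_assoc)
qed

lemma spsd_mexp_congruence:
  assumes "spsd M"
  shows "spsd (mexp B ** M ** mexp (transpose B))"
  using spsd_congruence[OF assms, of "mexp B"] by (simp add: transpose_mexp)

lemma spsd_if_ssprk2_stage1:
  assumes "spsd X" and "0 \<le> \<tau>" and "spsd (Q (grid_time t0 \<tau> n) X)"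
  shows "spsd (if_ssprk2_stage1 A Q t0 \<tau> n X)"
  \<comment> \<open>Pulling the scalar out of \<open>transpose (\<tau> *\<^sub>R A)\<close> gives
    the right-hand factor the form it has in the scheme.\<close>
  using assms spsd_mexp_congruence[of _ "\<tau> *\<^sub>R A"] unfolding if_ssprk2_stage1_def
  by (simp add: spsd_add spsd_scaleR linear_cmul[OF linear_transpose])

lemma spsd_if_ssprk2_stage2:
  assumes "spsd (if_ssprk2_stage1 A Q t0 \<tau> n X)" and "0 \<le> \<tau>"
    and "spsd (Q (grid_time t0 \<tau> (Suc n)) (if_ssprk2_stage1 A Q t0 \<tau> n X))"
  shows "spsd (if_ssprk2_stage2 A Q t0 \<tau> n X)"
  using assms spsd_mexp_congruence[of _ "\<tau> *\<^sub>R A"] unfolding if_ssprk2_stage2_def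
  by (simp add: spsd_add spsd_scaleR linear_cmul[OF linear_transpose])

text \<open>The conditions on \<open>Q\<close> range over all steps \<open>k\<close> since the
  induction passes through every earlier iterate; they concern only values met along the computed
  trajectory.\<close>

lemma spsd_if_ssprk2:
  assumes "spsd X0" and "0 \<le> \<tau>"
    and "\<And>k. spsd (Q (grid_time t0 \<tau> k) (if_ssprk2 A Q t0 \<tau> X0 k))"
    and "\<And>k. spsd (Q (grid_time t0 \<tau> (Suc k))
                 (if_ssprk2_stage1 A Q t0 \<tau> k (if_ssprk2 A Q t0 \<tau> X0 k)))"
  shows "spsd (if_ssprk2 A Q t0 \<tau> X0 n)"
proof (induction n)
  case 0
  show ?case using assms(1) by simp
next
  case (Suc n)
  let ?X = "if_ssprk2 A Q t0 \<tau> X0 n"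
  have "spsd (if_ssprk2_stage2 A Q t0 \<tau> n ?X)"
    using assms Suc by (intro spsd_if_ssprk2_stage2 spsd_if_ssprk2_stage1)
  \<comment> \<open>The backward factor is again a congruence, now with exponent
    \<open>- (\<tau> *\<^sub>R A)\<close>, so the sign of the exponent does no harm.\<close>
  then have "spsd (mexp (- (\<tau> *\<^sub>R A)) ** if_ssprk2_stage2 A Q t0 \<tau> n ?X
      ** mexp (- (\<tau> *\<^sub>R transpose A)))"
    using spsd_mexp_congruence[of _ "- (\<tau> *\<^sub>R A)"]
    by (simp add: linear_neg[OF linear_transpose] linear_cmul[OF linear_transpose])
  moreover have "spsd (mexp (\<tau> *\<^sub>R A) ** ?X ** mexp (\<tau> *\<^sub>R transpose A))"
    using spsd_mexp_congruence[OF Suc, of "\<tau> *\<^sub>R A"]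
    by (simp add: linear_cmul[OF linear_transpose])
  ultimately show ?case
    by (simp add: spsd_add spsd_scaleR)
qed

theorem theorem3p1:
  fixes A X0 :: "real ^ 'd ^ 'd"
    and Q :: "real \<Rightarrow> real ^ 'd ^ 'd \<Rightarrow> real ^ 'd ^ 'd"
    and t0 \<tau> :: real
    and n :: nat
  assumes "spsd X0"
    and "\<tau> > 0"
    and "\<And>k. spsd (Q (grid_time t0 \<tau> k) (if_ssprk2 A Q t0 \<tau> X0 k))"
    and "\<And>k. spsd (Q (grid_time t0 \<tau> (Suc k))
                 (if_ssprk2_stage1 A Q t0 \<tau> k (if_ssprk2 A Q t0 \<tau> X0 k)))"
  shows "spsd (if_ssprk2 A Q t0 \<tau> X0 (Suc n))"
  using assms by (intro spsd_if_ssprk2) simp_all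

end
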